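(* Let $n=k^2$, where $k$ is a positive integer, and consider the equation $$x^4+y^4+z^4-2x^2y^2-2y^2z^2-2z^2x^2=n .$$ Let $S_1$ be the set of all integer solutions $(a,b,c)$ of this equation with two among $a,b,c$ being zero, and let $S_2$ be the set of all rational solutions $(a,b,c)$ of this equation with two among $a,b,c$ being zero. Then: (i) If $k$ is not a perfect (integer) square, then $S_1=S_2=\emptyset$. (ii) If $k=m^2$ with $m$ a positive integer, then $$S_1=S_2=\{(\pm m,0,0),\ (0,\pm m,0),\ (0,0,\pm m)\}$$ (six solutions, all sign choices being allowed). *)

theory Defs
  imports Complex_Main "HOL-Computational_Algebra.Nth_Powers"
begin

definition is_solution :: "'a::comm_ring_1 \<Rightarrow> 'a \<Rightarrow> 'a \<Rightarrow> 'a \<Rightarrow> bool" where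
  "is_solution n x y z \<longleftrightarrow>
     x^4 + y^4 + z^4 - 2 * x^2 * y^2 - 2 * y^2 * z^2 - 2 * z^2 * x^2 = n"

text \<open>``Two among $a,b,c$ are zero'' is read as ``at least two''. For \<open>n \<noteq> 0\<close> this is the
  same as ``exactly two'', since \<open>(0, 0, 0)\<close> is then not a solution.\<close>

definition two_zero :: "'a::zero \<Rightarrow> 'a \<Rightarrow> 'a \<Rightarrow> bool" where
  "two_zero a b c \<longleftrightarrow> (a = 0 \<and> b = 0) \<or> (b = 0 \<and> c = 0) \<or> (c = 0 \<and> a = 0)"

definition S1 :: "int \<Rightarrow> (int \<times> int \<times> int) set" where
  "S1 n = {(a, b, c). is_solution n a b c \<and> two_zero a b c}"

definition S2 :: "int \<Rightarrow> (rat \<times> rat \<times> rat) set" where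
  "S2 n = {(a, b, c). is_solution (of_int n) a b c \<and> two_zero a b c}"

text \<open>The embedding along which a set of integer triples is regarded as a set of
  rational triples, so that the two solution sets can be compared.\<close>

definition rat_triple :: "int \<times> int \<times> int \<Rightarrow> rat \<times> rat \<times> rat" where
  "rat_triple = (\<lambda>(a, b, c). (of_int a, of_int b, of_int c))"

end

theory Submission
  imports Defs
begin

text \<open>
  When two of the three unknowns vanish, every mixed term of the equation vanishes too and
  the equation becomes \<open>t^4 = k^2\<close> for the remaining unknown \<open>t\<close>. In an ordered domain this
  means \<open>t^2 = k\<close>, because \<open>t^2 = -k\<close> is excluded by \<open>k > 0\<close>. A rational \<open>t\<close> with \<open>t^2 = k\<close> is a
  root of the monic integer polynomial \<open>X^2 - k\<close>, hence an integer. So the rational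
  solutions are the integer ones, they exist only if \<open>k\<close> is a perfect square, and for
  \<open>k = m^2\<close> they are given by \<open>t = m\<close> and \<open>t = -m\<close>, placed at any of the three coordinates.
\<close>

lemma axis_solutions_eq_fourth_roots:
  fixes N :: "'a::comm_ring_1"
  shows "{(a, b, c). is_solution N a b c \<and> two_zero a b c} =
    (\<Union>t\<in>{t. t^4 = N}. {(t, 0, 0), (0, t, 0), (0, 0, t)})"
  by (auto simp: is_solution_def two_zero_def)

lemma power4_eq_square_iff:
  fixes t k :: "'a::linordered_idom"
  assumes "k > 0"
  shows "t^4 = k^2 \<longleftrightarrow> t^2 = k"
proof -
  have "t^4 = (t^2)^2"
    by simp
  then show ?thesis
    using assms by (metis less_imp_le power2_eq_imp_eq zero_le_power2)
qed

lemma axis_solutions_eq_square_roots: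
  fixes k :: "'a::linordered_idom"
  assumes "k > 0"
  shows "{(a, b, c). is_solution (k^2) a b c \<and> two_zero a b c} =
    (\<Union>t\<in>{t. t^2 = k}. {(t, 0, 0), (0, t, 0), (0, 0, t)})"
  by (simp only: axis_solutions_eq_fourth_roots power4_eq_square_iff[OF assms])

text \<open>
  The integers are integrally closed in the rationals: write \<open>q = a / b\<close> in lowest terms;
  then \<open>b^2\<close> divides \<open>a^2\<close>, and coprimality leaves only \<open>b = 1\<close>.
\<close>

lemma rat_square_root_of_int_is_int:
  fixes q :: rat and k :: int
  assumes "q^2 = of_int k"
  shows "\<exists>t. q = of_int t"
proof -
  obtain a b where ab: "quotient_of q = (a, b)"
    by (cases "quotient_of q")
  have b: "b > 0" and q: "q = of_int a / of_int b" and cop: "coprime a b"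
    using ab by (simp_all add: quotient_of_denom_pos quotient_of_div quotient_of_coprime)
  have "of_int (a^2) = (of_int (k * b^2) :: rat)"
    using assms b by (simp add: q field_simps)
  then have "a^2 = k * b^2"
    by (simp only: of_int_eq_iff)
  then have "b dvd a"
    by (metis dvd_triv_right pow_divides_pow_iff zero_less_numeral)
  then have "b = 1"
    using b cop by (metis coprime_absorb_right is_unit_normalize normalize_int_def abs_of_pos)
  then show ?thesis
    using q by auto
qed

lemma rat_square_roots_of_int:
  fixes k :: int
  shows "{q :: rat. q^2 = of_int k} = of_int ` {t. t^2 = k}"
proof (intro set_eqI iffI)
  fix q :: rat
  assume "q \<in> {q. q^2 = of_int k}"
  then have sq: "q^2 = of_int k"
    by simp
  then obtain t where t: "q = of_int t"
    using rat_square_root_of_int_is_int by blast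
  have "of_int (t^2) = (of_int k :: rat)"
    using sq t by simp
  then have "t^2 = k"
    by (simp only: of_int_eq_iff)
  then show "q \<in> of_int ` {t. t^2 = k}"
    using t by blast
qed auto

theorem theorem7:
  fixes n k :: int
  assumes "k > 0" and "n = k^2"
  shows "(\<not> is_square k \<longrightarrow> S1 n = {} \<and> S2 n = {}) \<and>
    (\<forall>m::int. m > 0 \<and> k = m^2 \<longrightarrow>
       rat_triple ` S1 n = S2 n \<and>
       S1 n = {(m, 0, 0), (-m, 0, 0), (0, m, 0), (0, -m, 0), (0, 0, m), (0, 0, -m)} \<and>
       card (S1 n) = 6)"
proof -
  have S1: "S1 n = (\<Union>t\<in>{t. t^2 = k}. {(t, 0, 0), (0, t, 0), (0, 0, t)})"
    unfolding S1_def assms(2) by (rule axis_solutions_eq_square_roots[OF assms(1)])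
  have "S2 n = (\<Union>q\<in>{q. q^2 = of_int k}. {(q, 0, 0), (0, q, 0), (0, 0, q)})"
    unfolding S2_def assms(2) of_int_power
    by (rule axis_solutions_eq_square_roots) (simp add: assms(1))
  then have S2: "S2 n = rat_triple ` S1 n"
    unfolding S1 rat_square_roots_of_int by (simp add: image_UN rat_triple_def)
  show ?thesis
  proof (intro conjI impI allI)
    assume "\<not> is_square k"
    then have "{t. t^2 = k} = {}"
      by (auto simp: is_nth_power_def)
    then show "S1 n = {}" "S2 n = {}"
      by (simp_all add: S1 S2)
  next
    fix m :: int
    assume m: "m > 0 \<and> k = m^2"
    show "rat_triple ` S1 n = S2 n"
      by (simp add: S2)
    have "{t. t^2 = k} = {m, -m}"
      using m by (auto simp: power2_eq_iff)
    then show eq: "S1 n = {(m, 0, 0), (-m, 0, 0), (0, m, 0), (0, -m, 0), (0, 0, m), (0, 0, -m)}"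
      unfolding S1 by auto
    show "card (S1 n) = 6"
      unfolding eq using m by simp
  qed
qed

end
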